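(* Let $\mathbf A = \langle A, \to, 0\rangle$ be an implication zroupoid. Then the bisemigroup $\mathbf A_{mj} = \langle A, \wedge, \vee\rangle$ satisfies the Birkhoff identity: for all $x, y \in A$, $$x \wedge (x \vee y) = x \vee (x \wedge y).$$
   Context: An implication zroupoid is an algebra $\mathbf A = \langle A, \to, 0\rangle$, where $\to$ is a binary operation and $0$ is a constant, such that, writing $x' := x \to 0$ (and $x'' := (x')'$), the following hold for all $x,y,z\in A$: (1) $(x \to y) \to z = [(z' \to x) \to (y \to z)']'$, and (2) $0'' = 0$. For an implication zroupoid $\mathbf A$, define on $A$ the operations $x \wedge y := (x \to y')'$ and $x \vee y := (x' \wedge y')'$, and put $\mathbf A_{mj} := \langle A, \wedge, \vee\rangle$. A bisemigroup is an algebra with two associative binary operations; it is a known result that $\mathbf A_{mj}$ is a bisemigroup for every implication zroupoid $\mathbf A$. *)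

theory Defs
  imports Main
begin

locale zroupoid =
  fixes imp :: "'a \<Rightarrow> 'a \<Rightarrow> 'a"  (infixr "\<rightarrow>" 60)
    and zero :: 'a  ("\<zero>")
begin

definition neg :: "'a \<Rightarrow> 'a"
  where "neg x = x \<rightarrow> \<zero>"

definition meet :: "'a \<Rightarrow> 'a \<Rightarrow> 'a"
  where "meet x y = neg (x \<rightarrow> neg y)"

definition join :: "'a \<Rightarrow> 'a \<Rightarrow> 'a"
  where "join x y = neg (meet (neg x) (neg y))"

end

locale implication_zroupoid = zroupoid +
  assumes imp_imp: "(x \<rightarrow> y) \<rightarrow> z = neg ((neg z \<rightarrow> x) \<rightarrow> neg (y \<rightarrow> z))"
    and neg_neg_zero: "neg (neg \<zero>) = \<zero>"

end

(* The meet and join of an implication zroupoid are dual under negation, have the units 1 = 0' and 0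
   up to a double negation, and the axiom (1) says precisely that (x \<squnion> y) \<sqinter> z = (z \<sqinter> x) \<squnion> (y \<sqinter> z):
   distributivity with one factor switched. Putting y = 0, 1 here and in the dual law measures the
   failure of commutativity, x \<sqinter> z = (z \<sqinter> x) \<squnion> (0 \<sqinter> z), and gives many expressions for (1 \<squnion> x) \<sqinter> z.
   These yield x \<sqinter> (y \<sqinter> x) = y \<sqinter> x, hence x \<sqinter> (1 \<squnion> y) = x \<squnion> (0 \<sqinter> y). With s = x \<squnion> y and
   1 \<squnion> (x \<sqinter> y) = 1 \<squnion> s one then computes
   x \<squnion> (x \<sqinter> y) = (s \<sqinter> x) \<sqinter> (1 \<squnion> s) = (s \<sqinter> x) \<squnion> (0 \<sqinter> s) = x \<sqinter> s. *)

theory Submission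
  imports Defs
begin

context implication_zroupoid
begin

abbreviation one  ("\<one>")
  where "\<one> \<equiv> neg \<zero>"

notation meet (infixl "\<sqinter>" 70)
notation join (infixl "\<squnion>" 65)

lemma neg_imp: "neg (x \<rightarrow> y) = neg ((\<one> \<rightarrow> x) \<rightarrow> neg (neg y))"
  using imp_imp[of x y \<zero>] by (simp add: neg_def)

lemma neg_neg_one_imp: "neg (neg (\<one> \<rightarrow> x)) = neg (neg x)"
  using imp_imp[of x \<zero> \<zero>] neg_neg_zero by (simp add: neg_def)

lemma neg_imp_one_imp: "neg (x \<rightarrow> (\<one> \<rightarrow> y)) = neg (x \<rightarrow> y)"
  using neg_imp neg_neg_one_imp by metis

text \<open>By (1), \<open>(\<zero> \<rightarrow> x) \<rightarrow> z\<close> depends on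
  \<open>z\<close> only through \<open>neg (neg z)\<close> and
  \<open>neg (x \<rightarrow> z)\<close>; replacing \<open>y\<close> by
  \<open>\<one> \<rightarrow> y\<close> changes neither.\<close>

lemma zero_imp_imp_one_imp: "(\<zero> \<rightarrow> x) \<rightarrow> (\<one> \<rightarrow> y) = (\<zero> \<rightarrow> x) \<rightarrow> y"
proof -
  have "(\<zero> \<rightarrow> x) \<rightarrow> z = neg (neg (neg z) \<rightarrow> neg (x \<rightarrow> z))" for z
    using imp_imp[of \<zero> x z] by (simp add: neg_def)
  then show ?thesis
    by (simp add: neg_neg_one_imp neg_imp_one_imp)
qed

lemma neg_one_imp_imp: "neg ((\<one> \<rightarrow> x) \<rightarrow> y) = neg (x \<rightarrow> y)"
proof -
  have "\<one> \<rightarrow> (\<one> \<rightarrow> x) = \<one> \<rightarrow> x"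
    using zero_imp_imp_one_imp[of \<zero> x] by (simp add: neg_def)
  then show ?thesis
    using neg_imp[of "\<one> \<rightarrow> x" y] neg_imp[of x y] by simp
qed

lemma neg_imp_neg_neg_right: "neg (x \<rightarrow> neg (neg y)) = neg (x \<rightarrow> y)"
  using neg_imp[of x y] neg_one_imp_imp by simp

lemma neg4: "neg (neg (neg (neg x))) = neg (neg x)"
  using neg_neg_one_imp[of "neg (neg x)"] neg_imp_neg_neg_right[of \<one> x] neg_neg_one_imp[of x]
  by simp

lemma neg_imp_neg_neg_left: "neg (neg (neg x) \<rightarrow> y) = neg (x \<rightarrow> y)"
proof -
  \<comment> \<open>Since \<open>\<zero> \<rightarrow> \<zero>\<close> is \<open>\<one>\<close>,
    this determines \<open>\<one> \<rightarrow> z\<close> from two terms that do not change under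
    double negation of \<open>z\<close>.\<close>
  have "(\<zero> \<rightarrow> \<zero>) \<rightarrow> z = neg (neg (neg z) \<rightarrow> neg (\<zero> \<rightarrow> z))" for z
    using imp_imp[of \<zero> \<zero> z] by (simp add: neg_def)
  then have "\<one> \<rightarrow> neg (neg x) = \<one> \<rightarrow> x"
    by (metis neg4 neg_def neg_imp_neg_neg_right)
  then show ?thesis
    by (metis neg_one_imp_imp)
qed

lemma neg3_imp: "neg (neg (neg (x \<rightarrow> y))) = neg (x \<rightarrow> y)"
proof -
  \<comment> \<open>\<open>neg (neg x)\<close> is itself an implication, so (1) makes the whole term
    a negation, to which \<open>neg4\<close> applies.\<close>
  obtain u where "neg (neg x) \<rightarrow> y = neg u"
    using imp_imp[of "neg x" \<zero> y] by (auto simp: neg_def)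
  then have "neg (neg (neg (neg (neg x) \<rightarrow> y))) = neg (neg (neg x) \<rightarrow> y)"
    by (simp add: neg4)
  then show ?thesis
    by (simp add: neg_imp_neg_neg_left)
qed

lemma neg_neg_imp: "neg (neg (neg x \<rightarrow> y)) = neg x \<rightarrow> y"
  by (metis neg3_imp imp_imp neg_def)

lemma neg_neg_meet [simp]: "neg (neg (x \<sqinter> y)) = x \<sqinter> y"
  by (simp add: meet_def neg3_imp)

lemma neg_join: "neg (x \<squnion> y) = neg x \<sqinter> neg y"
  by (simp add: join_def)

lemma neg_neg_join [simp]: "neg (neg (x \<squnion> y)) = x \<squnion> y"
  by (simp add: neg_join) (simp add: join_def)

lemma meet_neg_neg [simp]:
  "neg (neg x) \<sqinter> y = x \<sqinter> y" "x \<sqinter> neg (neg y) = x \<sqinter> y"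
  by (simp_all add: meet_def neg_imp_neg_neg_left neg_imp_neg_neg_right)

lemma join_neg_neg [simp]:
  "neg (neg x) \<squnion> y = x \<squnion> y" "x \<squnion> neg (neg y) = x \<squnion> y"
  by (simp_all add: join_def)

lemma neg_meet: "neg (x \<sqinter> y) = neg x \<squnion> neg y"
  by (simp add: join_def)

text \<open>The bridge that turns (1) into a law about meet and join.\<close>

lemma join_eq_imp: "x \<squnion> y = neg x \<rightarrow> y"
  by (simp add: join_def meet_def neg_imp_neg_neg_right neg_neg_imp)

lemma meet_join_distrib: "(x \<squnion> y) \<sqinter> z = (z \<sqinter> x) \<squnion> (y \<sqinter> z)"
proof -
  have "(x \<squnion> y) \<sqinter> z = neg (neg ((neg (neg z) \<rightarrow> neg x) \<rightarrow> neg (y \<rightarrow> neg z)))"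
    by (simp add: meet_def join_eq_imp imp_imp[of "neg x"])
  also have "\<dots> = neg (neg (neg (z \<sqinter> x) \<rightarrow> y \<sqinter> z))"
    by (metis meet_def neg_imp_neg_neg_left)
  also have "\<dots> = (z \<sqinter> x) \<squnion> (y \<sqinter> z)"
    by (simp add: join_eq_imp neg_neg_imp)
  finally show ?thesis .
qed

lemma join_meet_distrib: "(x \<sqinter> y) \<squnion> z = (z \<squnion> x) \<sqinter> (y \<squnion> z)"
proof -
  have "(x \<sqinter> y) \<squnion> z = neg ((neg x \<squnion> neg y) \<sqinter> neg z)"
    by (simp add: neg_meet[symmetric]) (simp add: join_def)
  also have "\<dots> = (z \<squnion> x) \<sqinter> (y \<squnion> z)"
    unfolding meet_join_distrib[of "neg x"] neg_join by (simp add: join_def)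
  finally show ?thesis .
qed

lemma meet_one: "x \<sqinter> \<one> = neg (neg x)"
  by (simp add: meet_def neg_neg_zero neg_def[symmetric])

lemma one_meet: "\<one> \<sqinter> x = neg (neg x)"
  using neg_neg_one_imp[of "neg x"] neg_neg_one_imp[of x] neg_imp_neg_neg_right
  by (metis meet_def neg3_imp neg_def)

lemma join_zero: "x \<squnion> \<zero> = neg (neg x)"
  by (simp add: join_eq_imp neg_def)

lemma zero_join: "\<zero> \<squnion> x = neg (neg x)"
  by (simp add: join_def one_meet neg4)

text \<open>As \<open>\<zero>\<close> is idempotent, distributing
  \<open>(x \<squnion> \<zero>) \<sqinter> \<zero>\<close> leaves
  \<open>\<zero> \<sqinter> x \<squnion> \<zero>\<close>.\<close>

lemma meet_zero: "x \<sqinter> \<zero> = \<zero> \<sqinter> x"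
proof -
  have "\<zero> \<sqinter> \<zero> = \<zero>"
    using meet_join_distrib[of \<one> \<zero> \<zero>]
    by (simp add: join_zero one_meet meet_one zero_join neg_neg_zero)
  then show ?thesis
    using meet_join_distrib[of x \<zero> \<zero>] by (simp add: join_zero)
qed

lemma join_one: "x \<squnion> \<one> = \<one> \<squnion> x"
  using meet_zero[of "neg x"] by (simp add: join_def neg_neg_zero)

lemma zero_meet_join_self: "\<zero> \<sqinter> x \<squnion> x = neg (neg x)"
  using meet_join_distrib[of \<zero> \<one> x] by (simp add: meet_one one_meet zero_join meet_zero)

lemma meet_commute_defect: "x \<sqinter> y = y \<sqinter> x \<squnion> \<zero> \<sqinter> y"
  using meet_join_distrib[of x \<zero> y] by (simp add: join_zero)

lemma join_commute_defect: "x \<squnion> y = (y \<squnion> x) \<sqinter> (\<one> \<squnion> y)"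
  using join_meet_distrib[of x \<one> y] by (simp add: meet_one)

lemma meet_idem: "x \<sqinter> x = neg (neg x)"
  by (metis join_meet_distrib join_zero neg_join neg_neg_meet zero_meet_join_self)

lemma join_idem: "x \<squnion> x = neg (neg x)"
  by (simp add: join_def meet_idem neg4)

text \<open>Comparing these forms replaces commutativity: the first and the fifth swap the factors
  of a meet under a join with \<open>y\<close>.\<close>

lemma one_join_meet:
  shows "(\<one> \<squnion> x) \<sqinter> y = y \<sqinter> x \<squnion> y"
    and "(\<one> \<squnion> x) \<sqinter> y = (y \<squnion> x) \<sqinter> y"
    and "(\<one> \<squnion> x) \<sqinter> y = y \<sqinter> (x \<squnion> y)"
    and "(\<one> \<squnion> x) \<sqinter> y = \<zero> \<sqinter> x \<squnion> y"
    and "(\<one> \<squnion> x) \<sqinter> y = x \<sqinter> y \<squnion> y"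
proof -
  show 1: "(\<one> \<squnion> x) \<sqinter> y = y \<sqinter> x \<squnion> y"
    by (simp flip: join_one add: meet_join_distrib one_meet)
  show 2: "(\<one> \<squnion> x) \<sqinter> y = (y \<squnion> x) \<sqinter> y"
    by (simp add: meet_join_distrib meet_one meet_idem)
  show 3: "(\<one> \<squnion> x) \<sqinter> y = y \<sqinter> (x \<squnion> y)"
    by (simp add: 1 join_meet_distrib join_idem)
  show "(\<one> \<squnion> x) \<sqinter> y = \<zero> \<sqinter> x \<squnion> y"
    by (simp add: 3 join_meet_distrib join_zero)
  show "(\<one> \<squnion> x) \<sqinter> y = x \<sqinter> y \<squnion> y"
    by (simp add: 2 join_meet_distrib join_idem)
qed

text \<open>Both sides are \<open>\<zero> \<sqinter> x \<squnion> y \<sqinter> x\<close>: the left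
  by the fourth form, the right by distributing
  \<open>(\<zero> \<squnion> y) \<sqinter> x\<close>.\<close>

lemma one_join_absorb: "(\<one> \<squnion> x) \<sqinter> (y \<sqinter> x) = y \<sqinter> x"
  using meet_join_distrib[of \<zero> y x]
  by (metis meet_zero one_join_meet(4) zero_join meet_neg_neg(1) meet_commute_defect)

lemma one_join_zero_meet: "\<one> \<squnion> \<zero> \<sqinter> x = \<one> \<squnion> x"
  using one_join_meet(4)[of x \<one>] by (simp add: meet_one join_one)

lemma meet_one_join_meet: "y \<sqinter> ((\<one> \<squnion> x) \<sqinter> y) = (\<one> \<squnion> x) \<sqinter> y"
  by (metis one_join_meet(3,4) one_join_zero_meet)

lemma one_join_meet_meet: "(\<one> \<squnion> x \<sqinter> y) \<sqinter> y = (\<one> \<squnion> x) \<sqinter> y"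
  by (metis one_join_meet(3,5) meet_one_join_meet)

text \<open>Distributing \<open>(y \<sqinter> x \<squnion> y) \<sqinter> x\<close> gives
  \<open>x \<sqinter> (y \<sqinter> x) \<squnion> y \<sqinter> x\<close>, by the fifth form the left
  side of \<open>one_join_absorb\<close>.\<close>

lemma one_join_meet_swap: "((\<one> \<squnion> x) \<sqinter> y) \<sqinter> x = y \<sqinter> x"
  by (metis one_join_meet(1,5) meet_join_distrib one_join_absorb)

lemma meet_left_idem: "x \<sqinter> (y \<sqinter> x) = y \<sqinter> x"
proof -
  have "y \<sqinter> x = (y \<sqinter> x \<squnion> x) \<sqinter> (y \<sqinter> x)"
    using one_join_absorb one_join_meet(2) by metis
  \<comment> \<open>The first factor is reshaped so that \<open>one_join_meet_swap\<close> applies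
    with \<open>y \<sqinter> x\<close> in the role of its \<open>x\<close>.\<close>
  also have "\<dots> = ((\<one> \<squnion> y \<sqinter> x) \<sqinter> x) \<sqinter> (y \<sqinter> x)"
    by (metis one_join_meet(5) one_join_meet_meet)
  also have "\<dots> = x \<sqinter> (y \<sqinter> x)"
    by (rule one_join_meet_swap)
  finally show ?thesis by simp
qed

lemma join_left_idem: "x \<squnion> (y \<squnion> x) = y \<squnion> x"
  by (simp add: join_def meet_left_idem)

lemma meet_one_join: "x \<sqinter> (\<one> \<squnion> y) = x \<squnion> \<zero> \<sqinter> y"
proof -
  have "x \<squnion> \<zero> \<sqinter> y = (\<zero> \<sqinter> y \<squnion> x) \<sqinter> (\<one> \<squnion> \<zero> \<sqinter> y)"
    by (rule join_commute_defect)
  \<comment> \<open>Distributing produces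
    \<open>(\<one> \<squnion> y) \<sqinter> (\<zero> \<sqinter> y)\<close>, which absorption reduces
    to \<open>\<zero> \<sqinter> y\<close>.\<close>
  also have "\<dots> = \<zero> \<sqinter> y \<squnion> x \<sqinter> (\<one> \<squnion> y)"
    using meet_join_distrib[of "\<zero> \<sqinter> y" x "\<one> \<squnion> y"]
    by (simp add: one_join_zero_meet one_join_absorb)
  also have "\<dots> = (\<one> \<squnion> y) \<sqinter> (x \<sqinter> (\<one> \<squnion> y))"
    by (simp add: one_join_meet(4))
  also have "\<dots> = x \<sqinter> (\<one> \<squnion> y)"
    by (rule meet_left_idem)
  finally show ?thesis by simp
qed

lemma one_join_meet_eq_one_join_join: "\<one> \<squnion> x \<sqinter> y = \<one> \<squnion> (x \<squnion> y)"
proof -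
  have "\<one> \<squnion> x \<sqinter> y = (\<one> \<squnion> x) \<sqinter> (\<one> \<squnion> y)"
    using join_meet_distrib[of x y \<one>] by (simp add: join_one)
  \<comment> \<open>Distributing the right side produces a second \<open>\<one>\<close> joined to
    \<open>\<one> \<squnion> x\<close>, which left idempotence removes.\<close>
  also have "\<dots> = \<one> \<squnion> (\<one> \<squnion> x) \<sqinter> y"
    using join_meet_distrib[of "\<one> \<squnion> x" y \<one>] join_left_idem[of \<one> x]
    by (simp add: join_one)
  also have "\<dots> = \<one> \<squnion> \<zero> \<sqinter> (\<zero> \<sqinter> x \<squnion> y)"
    by (simp add: one_join_zero_meet one_join_meet(4))
  \<comment> \<open>Distributing over the outer \<open>\<zero>\<close> turns \<open>x\<close> into
    \<open>\<zero> \<sqinter> x\<close> anyway, so the inner \<open>\<zero>\<close> is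
    absorbed.\<close>
  also have "\<zero> \<sqinter> (\<zero> \<sqinter> x \<squnion> y) = \<zero> \<sqinter> (x \<squnion> y)"
    using meet_join_distrib[of "\<zero> \<sqinter> x" y \<zero>] meet_join_distrib[of x y \<zero>]
      meet_left_idem[of \<zero> x]
    by (simp add: meet_zero)
  finally show ?thesis by (simp add: one_join_zero_meet)
qed

lemma birkhoff: "x \<sqinter> (x \<squnion> y) = x \<squnion> x \<sqinter> y"
proof -
  let ?s = "x \<squnion> y"
  have "x \<squnion> x \<sqinter> y = (x \<sqinter> y \<squnion> x) \<sqinter> (\<one> \<squnion> x \<sqinter> y)"
    by (rule join_commute_defect)
  \<comment> \<open>\<open>x \<sqinter> y \<squnion> x\<close> and \<open>?s \<sqinter> x\<close>
    are two forms of \<open>(\<one> \<squnion> y) \<sqinter> x\<close>.\<close>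
  also have "\<dots> = (?s \<sqinter> x) \<sqinter> (\<one> \<squnion> ?s)"
    by (metis one_join_meet(1,2) one_join_meet_eq_one_join_join)
  also have "\<dots> = ?s \<sqinter> x \<squnion> \<zero> \<sqinter> ?s"
    by (rule meet_one_join)
  also have "\<dots> = x \<sqinter> ?s"
    by (rule meet_commute_defect[symmetric])
  finally show ?thesis by simp
qed

end

theorem theorem1p4:
  fixes imp :: "'a \<Rightarrow> 'a \<Rightarrow> 'a" and zero :: 'a
  assumes "implication_zroupoid imp zero"
  shows "\<forall>x y. zroupoid.meet imp zero x (zroupoid.join imp zero x y)
             = zroupoid.join imp zero x (zroupoid.meet imp zero x y)"
  using implication_zroupoid.birkhoff[OF assms] by blast

end
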